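(* Let $t\in[0,T]$ be arbitrary. There exist a subset $S(t)\subset I[t](\widehat{x}_\infty(t))$ with cardinality $|S(t)|=p\le n+1$ and coefficients $\alpha(t)=(\alpha_k(t))_{k\in S(t)}\in[0,1]^p$ such that (i) $\sum_{k\in S(t)}\alpha_k(t)=1$; (ii) the vectors $\{P_k(t)(\widehat{x}_\infty(t)-\widehat{x}_k(t))\}_{k\in S(t)}$ are affinely independent; (iii) $\displaystyle \widehat{x}_\infty(t)=\left(\sum_{k\in S(t)}\alpha_k(t)P_k(t)\right)^{-1}\sum_{k\in S(t)}\alpha_k(t)P_k(t)\widehat{x}_k(t).$
   Context: Setting. Fix $T>0$, $n,m,r\in\mathbb{N}$, $B\in\mathbb{R}^{n\times m}$, $C\in\mathbb{R}^{r\times n}$, $x_0\in\mathbb{R}^n$ and a measured output $y\in L^2(0,T;\mathbb{R}^r)$. $\|\cdot\|$ is the Euclidean norm, and $\|x\|_M^2=x^\top M x$ for a symmetric positive definite matrix $M$. Let $\Sigma=\Sigma_A\times\Sigma_\Gamma\times\Sigma_R\times\Sigma_Q$ be a product of finite nonempty sets, $\Sigma=\{\sigma_1,\dots,\sigma_N\}$, $N=|\Sigma|$. To each $\sigma=(\sigma_A,\sigma_\Gamma,\sigma_R,\sigma_Q)$ are assigned matrices $A_\sigma\in\mathbb{R}^{n\times n}$ (depending on $\sigma_A$ only) and symmetric positive definite matrices $\Gamma_\sigma\in\mathbb{R}^{n\times n}$, $R_\sigma\in\mathbb{R}^{m\times m}$, $Q_\sigma\in\mathbb{R}^{r\times r}$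 (depending only on $\sigma_\Gamma$, $\sigma_R$, $\sigma_Q$ respectively). Index $k$ means $\sigma=\sigma_k$. For each $k$, $\Pi_k$ is the unique solution on $[0,T]$ of $\dot\Pi_k = A_k\Pi_k+\Pi_kA_k^\top-\Pi_kC^\top Q_k^{-1}C\Pi_k+BR_kB^\top$, $\Pi_k(0)=\Gamma_k$ (symmetric positive definite for all $t$), $P_k(t)=\Pi_k(t)^{-1}$ (infinitely differentiable in $t$), and $\widehat{x}_k\in H^1(0,T;\mathbb{R}^n)$ solves $\dot{\widehat{x}}_k=A_k\widehat{x}_k+\Pi_kC^\top Q_k^{-1}(y-C\widehat{x}_k)$, $\widehat{x}_k(0)=x_0$. Set $r_k(t)=\int_0^t\|y(s)-C\widehat{x}_k(s)\|_{Q_k^{-1}}^2\,ds$ and $\mathcal{V}_k(t,x)=\|x-\widehat{x}_k(t)\|_{P_k(t)}^2+r_k(t)$. For $t\in[0,T]$ put $f[t](x)=\max_{k=1,\dots,N}\mathcal{V}_k(t,x)$, $x\in\mathbb{R}^n$. The estimator $\widehat{x}_\infty(t)$ is the unique minimizer of $f[t]$ over $\mathbb{R}^n$, and the set of active indices at $x\in\mathbb{R}^n$ is $I[t](x)=\{k\in\{1,\dots,N\}:\mathcal{V}_k(t,x)=f[t](x)\}$. *)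

theory Defs
  imports "HOL-Analysis.Analysis"
begin

text \<open>
  Dimensions are index types: \<^typ>\<open>real ^ 'm ^ 'n\<close> is the type of n x m matrices
  (n rows, m columns).
\<close>

definition sym_pos_def :: "real ^ 'n ^ 'n \<Rightarrow> bool" where
  "sym_pos_def M \<longleftrightarrow> transpose M = M \<and> (\<forall>x. x \<noteq> 0 \<longrightarrow> x \<bullet> (M *v x) > 0)"

definition sq_norm_wrt :: "real ^ 'n ^ 'n \<Rightarrow> real ^ 'n \<Rightarrow> real" where
  "sq_norm_wrt M x = x \<bullet> (M *v x)"

text \<open>
  Square-integrable functions and first-order Sobolev functions on the open interval from 0 to T.
  Elements are functions, not almost-everywhere classes.
\<close>

definition L2 :: "real \<Rightarrow> (real \<Rightarrow> real ^ 'k) set" where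
  "L2 T = {u. u \<in> borel_measurable (lebesgue_on {0<..<T}) \<and>
              integrable (lebesgue_on {0<..<T}) (\<lambda>t. (norm (u t))\<^sup>2)}"

definition test_function :: "real \<Rightarrow> (real \<Rightarrow> real) \<Rightarrow> bool" where
  "test_function T \<phi> \<longleftrightarrow>
     (\<forall>j t. ((deriv ^^ j) \<phi>) differentiable (at t)) \<and>
     (\<exists>K. compact K \<and> K \<subseteq> {0<..<T} \<and> (\<forall>t. t \<notin> K \<longrightarrow> \<phi> t = 0))"

definition has_L2_weak_deriv ::
    "real \<Rightarrow> (real \<Rightarrow> real ^ 'k) \<Rightarrow> (real \<Rightarrow> real ^ 'k) \<Rightarrow> bool" where
  "has_L2_weak_deriv T u v \<longleftrightarrow> v \<in> L2 T \<and>
     (\<forall>\<phi>. test_function T \<phi> \<longrightarrow>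
        (LINT t|lebesgue_on {0<..<T}. deriv \<phi> t *\<^sub>R u t) =
        - (LINT t|lebesgue_on {0<..<T}. \<phi> t *\<^sub>R v t))"

definition H1 :: "real \<Rightarrow> (real \<Rightarrow> real ^ 'k) set" where
  "H1 T = {u \<in> L2 T. \<exists>v. has_L2_weak_deriv T u v}"

definition riccati_solution ::
    "real \<Rightarrow> real ^ 'n ^ 'n \<Rightarrow> real ^ 'm ^ 'n \<Rightarrow> real ^ 'n ^ 'r \<Rightarrow>
     real ^ 'n ^ 'n \<Rightarrow> real ^ 'm ^ 'm \<Rightarrow> real ^ 'r ^ 'r \<Rightarrow> (real \<Rightarrow> real ^ 'n ^ 'n) \<Rightarrow> bool" where
  "riccati_solution T A B C \<Gamma> R Q X \<longleftrightarrow>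
     (\<forall>t\<in>{0..T}.
        (X has_vector_derivative
           (A ** X t + X t ** transpose A
              - X t ** transpose C ** matrix_inv Q ** C ** X t
              + B ** R ** transpose B)) (at t within {0..T})) \<and>
     X 0 = \<Gamma>"

text \<open>
  The trajectory is the continuous representative of its Sobolev class, so that its value at every
  single time (in particular the initial value) is meaningful; the differential equation holds in
  the sense of weak derivatives, that is, almost everywhere.
\<close>

definition filter_solution ::
    "real \<Rightarrow> real ^ 'n ^ 'n \<Rightarrow> real ^ 'n ^ 'r \<Rightarrow> real ^ 'r ^ 'r \<Rightarrow> (real \<Rightarrow> real ^ 'n ^ 'n) \<Rightarrow>
     (real \<Rightarrow> real ^ 'r) \<Rightarrow> real ^ 'n \<Rightarrow> (real \<Rightarrow> real ^ 'n) \<Rightarrow> bool" where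
  "filter_solution T A C Q X y x0 xh \<longleftrightarrow>
     xh \<in> H1 T \<and> continuous_on {0..T} xh \<and>
     has_L2_weak_deriv T xh
       (\<lambda>t. A *v xh t + (X t ** transpose C ** matrix_inv Q) *v (y t - C *v xh t)) \<and>
     xh 0 = x0"

definition residual ::
    "real ^ 'n ^ 'r \<Rightarrow> real ^ 'r ^ 'r \<Rightarrow> (real \<Rightarrow> real ^ 'r) \<Rightarrow> (real \<Rightarrow> real ^ 'n) \<Rightarrow> real \<Rightarrow> real" where
  "residual C Q y xh t =
     (LINT s|lebesgue_on {0..t}. sq_norm_wrt (matrix_inv Q) (y s - C *v xh s))"

definition value_fun ::
    "real ^ 'n ^ 'r \<Rightarrow> real ^ 'r ^ 'r \<Rightarrow> (real \<Rightarrow> real ^ 'r) \<Rightarrow> (real \<Rightarrow> real ^ 'n ^ 'n) \<Rightarrow>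
     (real \<Rightarrow> real ^ 'n) \<Rightarrow> real \<Rightarrow> real ^ 'n \<Rightarrow> real" where
  "value_fun C Q y X xh t x =
     sq_norm_wrt (matrix_inv (X t)) (x - xh t) + residual C Q y xh t"

definition max_cost :: "nat \<Rightarrow> (nat \<Rightarrow> real \<Rightarrow> real ^ 'n \<Rightarrow> real) \<Rightarrow> real \<Rightarrow> real ^ 'n \<Rightarrow> real" where
  "max_cost N V t x = Max ((\<lambda>k. V k t x) ` {1..N})"

definition minimax_estimator ::
    "nat \<Rightarrow> (nat \<Rightarrow> real \<Rightarrow> real ^ 'n \<Rightarrow> real) \<Rightarrow> real \<Rightarrow> real ^ 'n" where
  "minimax_estimator N V t = (THE x. is_arg_min (max_cost N V t) (\<lambda>_. True) x)"

definition active_indices ::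
    "nat \<Rightarrow> (nat \<Rightarrow> real \<Rightarrow> real ^ 'n \<Rightarrow> real) \<Rightarrow> real \<Rightarrow> real ^ 'n \<Rightarrow> nat set" where
  "active_indices N V t x = {k \<in> {1..N}. V k t x = max_cost N V t x}"

text \<open>
  Affine independence of an indexed family: repeated vectors count as dependent, hence the
  injectivity requirement in addition to affine independence of the set of values.
\<close>

definition affinely_independent_family :: "('i \<Rightarrow> real ^ 'n) \<Rightarrow> 'i set \<Rightarrow> bool" where
  "affinely_independent_family w S \<longleftrightarrow> inj_on w S \<and> \<not> affine_dependent (w ` S)"

end

theory Submission
  imports Defs
begin

text \<open>
  The argument takes place at one time t.  There the cost is the maximum of finitely many functions
  \<open>q k x = sq_norm_wrt (P k t) (x - xh k t) + r k\<close>, and the numbers \<open>r k\<close> enter only as constants.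
  If all \<open>P k t\<close> are symmetric positive definite, the \<open>q k\<close> are coercive and strictly convex, so the
  maximum has exactly one minimizer, which is therefore the estimator
  (\<open>max_quadratic_attains_min\<close>, \<open>max_quadratic_min_unique\<close>).  At the minimizer no direction
  decreases all active functions to first order, which by separation means that the origin is
  a convex combination of the vectors \<open>P k t *v (xinf t - xh k t)\<close> with k active, these being half
  the gradients (\<open>max_quadratic_min_zero_in_hull\<close>).  A shortest such combination uses affinely
  independent vectors, hence at most \<open>n + 1\<close> of them
  (\<open>convex_hull_image_affinely_independent_family\<close>).  Written out, the combination says
  \<open>(\<Sum>k\<in>S. \<alpha> k *\<^sub>R P k t) *v xinf t = (\<Sum>k\<in>S. \<alpha> k *\<^sub>R (P k t *v xh k t))\<close>, and the matrix on the left
  is invertible as a convex combination of positive definite matrices.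

  It remains to see that the Riccati solutions, and with them their inverses \<open>P k t\<close>, are symmetric
  positive definite on the whole time interval.  Symmetry is a uniqueness statement:
  the antisymmetric part solves a homogeneous linear equation with initial value zero
  (\<open>riccati_symmetric\<close>).  Positivity is a comparison: an exponentially decaying barrier
  below the smallest eigenvalue at time 0 is never reached, since along an eigenvector
  with small positive eigenvalue \<open>\<mu>\<close> the Riccati right-hand side is bounded below by a multiple of
  \<open>- \<mu>\<close> (\<open>riccati_pos_def\<close>).
\<close>

section \<open>Symmetric and positive definite matrices\<close>

lemma inner_mult_transpose:
  fixes M :: "real ^ 'm ^ 'n"
  shows "x \<bullet> (transpose M *v y) = (M *v x) \<bullet> y"
  by (metis dot_lmul_matrix transpose_transpose transpose_matrix_vector)

lemma inner_mult_symmetric: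
  fixes M :: "real ^ 'n ^ 'n"
  assumes "transpose M = M"
  shows "x \<bullet> (M *v y) = y \<bullet> (M *v x)"
  by (metis assms inner_mult_transpose inner_commute)

lemma sq_norm_wrt_add:
  fixes M :: "real ^ 'n ^ 'n"
  assumes "transpose M = M"
  shows "sq_norm_wrt M (x + y) = sq_norm_wrt M x + 2 * (y \<bullet> (M *v x)) + sq_norm_wrt M y"
  using inner_mult_symmetric[OF assms, of x y]
  by (simp add: sq_norm_wrt_def matrix_vector_right_distrib inner_add_left inner_add_right)

lemma sq_norm_wrt_scaleR: "sq_norm_wrt M (c *\<^sub>R x) = c\<^sup>2 * sq_norm_wrt M x"
  by (simp add: sq_norm_wrt_def matrix_vector_mult_scaleR power2_eq_square)

lemma bounded_linear_quadratic_form: "bounded_linear (\<lambda>M :: real ^ 'n ^ 'n. sq_norm_wrt M z)"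
  unfolding linear_conv_bounded_linear[symmetric] sq_norm_wrt_def
  by (rule linearI)
    (simp_all add: matrix_vector_mult_add_rdistrib inner_add_right flip: scaleR_matrix_vector_assoc)

lemma sq_norm_wrt_sum:
  "sq_norm_wrt (\<Sum>k\<in>S. a k *\<^sub>R M k) x = (\<Sum>k\<in>S. a k * sq_norm_wrt (M k) x)"
  using bounded_linear.linear[OF bounded_linear_quadratic_form[of x]]
  by (simp add: linear_sum[of "\<lambda>M. sq_norm_wrt M x"] linear_cmul[of "\<lambda>M. sq_norm_wrt M x"])

lemma matrix_inv_right:
  fixes M :: "real ^ 'n ^ 'n"
  assumes "invertible M"
  shows "M ** matrix_inv M = mat 1"
  using assms unfolding invertible_def matrix_inv_def by (rule someI2_ex) simp

lemma matrix_inv_left: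
  fixes M :: "real ^ 'n ^ 'n"
  assumes "invertible M"
  shows "matrix_inv M ** M = mat 1"
  using matrix_inv_right[OF assms] matrix_left_right_inverse by blast

lemma invertible_if_kernel_trivial:
  fixes M :: "real ^ 'n ^ 'n"
  assumes "\<And>x. M *v x = 0 \<Longrightarrow> x = 0"
  shows "invertible M"
  using assms by (auto simp: invertible_left_inverse matrix_left_invertible_ker)

lemma sym_pos_def_nonneg: "sym_pos_def M \<Longrightarrow> sq_norm_wrt M x \<ge> 0"
  by (cases "x = 0") (auto simp: sym_pos_def_def sq_norm_wrt_def less_imp_le)

lemma sym_pos_def_invertible: "sym_pos_def M \<Longrightarrow> invertible M"
  by (rule invertible_if_kernel_trivial) (force simp: sym_pos_def_def)

lemma sym_pos_def_matrix_inv: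
  fixes M :: "real ^ 'n ^ 'n"
  assumes "sym_pos_def M"
  shows "sym_pos_def (matrix_inv M)"
proof -
  let ?P = "matrix_inv M"
  have MP: "M ** ?P = mat 1" and PM: "?P ** M = mat 1"
    using sym_pos_def_invertible[OF assms] by (simp_all add: matrix_inv_right matrix_inv_left)
  have M: "transpose M = M"
    using assms by (simp add: sym_pos_def_def)
  have "transpose ?P = transpose ?P ** (M ** ?P)"
    by (simp add: MP)
  also have "\<dots> = transpose (M ** ?P) ** ?P"
    by (simp add: matrix_transpose_mul M matrix_mul_assoc)
  also have "\<dots> = ?P"
    by (simp add: MP)
  finally have sym: "transpose ?P = ?P" .
  have "x \<bullet> (?P *v x) > 0" if "x \<noteq> 0" for x
  proof -
    have x: "M *v (?P *v x) = x"
      by (simp add: matrix_vector_mul_assoc MP)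
    then have "?P *v x \<noteq> 0"
      using that by auto
    then have "(?P *v x) \<bullet> (M *v (?P *v x)) > 0"
      using assms by (simp add: sym_pos_def_def)
    then show ?thesis
      by (simp add: x inner_commute)
  qed
  with sym show ?thesis
    by (simp add: sym_pos_def_def)
qed

text \<open>
  By homogeneity the minimum of the form over the compact unit sphere serves as the constant.
\<close>

lemma sym_pos_def_coercive:
  fixes M :: "real ^ 'n ^ 'n"
  assumes "sym_pos_def M"
  shows "\<exists>c>0. \<forall>x. c * (norm x)\<^sup>2 \<le> sq_norm_wrt M x"
proof -
  have "continuous_on (sphere 0 1) (sq_norm_wrt M)"
    unfolding sq_norm_wrt_def by (intro continuous_intros linear_continuous_on) auto
  moreover have "axis undefined 1 \<in> sphere (0 :: real ^ 'n) 1"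
    by simp
  ultimately obtain u where u: "norm u = 1" "\<And>z. norm z = 1 \<Longrightarrow> sq_norm_wrt M u \<le> sq_norm_wrt M z"
    using continuous_attains_inf[of "sphere 0 1" "sq_norm_wrt M"] by auto
  have "sq_norm_wrt M u * (norm x)\<^sup>2 \<le> sq_norm_wrt M x" for x
  proof (cases "x = 0")
    case False
    let ?z = "(1 / norm x) *\<^sub>R x"
    have "sq_norm_wrt M u \<le> sq_norm_wrt M ?z"
      using False by (intro u(2)) simp
    also have "\<dots> = sq_norm_wrt M x / (norm x)\<^sup>2"
      by (simp add: sq_norm_wrt_scaleR power_divide)
    finally show ?thesis
      using False by (simp add: field_simps)
  qed (simp add: sq_norm_wrt_def)
  moreover have "sq_norm_wrt M u > 0"
    using u(1) assms by (metis norm_zero sq_norm_wrt_def sym_pos_def_def zero_neq_one)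
  ultimately show ?thesis
    by blast
qed

text \<open>
  A nonnegative quadratic form vanishes only on the kernel of its matrix: at such a zero z the
  form is stationary, so the linear term in its expansion around z must vanish.
\<close>

lemma nonneg_form_zero_imp_kernel:
  fixes M :: "real ^ 'n ^ 'n"
  assumes sym: "transpose M = M" and nonneg: "\<And>x. sq_norm_wrt M x \<ge> 0"
    and zero: "sq_norm_wrt M z = 0"
  shows "M *v z = 0"
proof (rule ccontr)
  assume "M *v z \<noteq> 0"
  define w where "w = M *v z"
  have w: "w \<bullet> w > 0"
    using \<open>M *v z \<noteq> 0\<close> by (simp add: w_def)
  define q where "q = sq_norm_wrt M w"
  have q: "q \<ge> 0"
    using nonneg by (simp add: q_def)
  define e where "e = (w \<bullet> w) / (q + 1)"
  have e: "e > 0"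
    using w q by (simp add: e_def)
  (* moving from z against w lowers the form to first order; e is small enough to win over q *)
  have "sq_norm_wrt M (z + (- e) *\<^sub>R w)
      = sq_norm_wrt M z + 2 * (((- e) *\<^sub>R w) \<bullet> (M *v z)) + sq_norm_wrt M ((- e) *\<^sub>R w)"
    by (rule sq_norm_wrt_add[OF sym])
  also have "\<dots> = e * (e * q - 2 * (w \<bullet> w))"
    unfolding sq_norm_wrt_scaleR zero w_def[symmetric] q_def[symmetric]
    by (simp add: power2_eq_square algebra_simps)
  finally have "sq_norm_wrt M (z + (- e) *\<^sub>R w) = e * (e * q - 2 * (w \<bullet> w))" .
  moreover have "e * q \<le> w \<bullet> w"
    using w q by (simp add: e_def field_simps)
  ultimately have "sq_norm_wrt M (z + (- e) *\<^sub>R w) < 0"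
    using e w mult_pos_neg[of e "e * q - 2 * (w \<bullet> w)"] by linarith
  then show False
    using nonneg[of "z + (- e) *\<^sub>R w"] by linarith
qed

section \<open>Riccati solutions stay symmetric and positive definite\<close>

lemma bounded_bilinear_matrix_mult:
  "bounded_bilinear ((**) :: real ^ 'm ^ 'n \<Rightarrow> real ^ 'p ^ 'm \<Rightarrow> real ^ 'p ^ 'n)"
  unfolding bilinear_conv_bounded_bilinear[symmetric] bilinear_def
  by (auto intro!: linearI simp: matrix_matrix_mult_def vec_eq_iff sum.distrib
      sum_distrib_left algebra_simps)

lemma bounded_linear_transpose: "bounded_linear (transpose :: real ^ 'm ^ 'n \<Rightarrow> real ^ 'n ^ 'm)"
  unfolding linear_conv_bounded_linear[symmetric]
  by (intro linearI) (simp_all add: transpose_def vec_eq_iff)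

text \<open>
  Gronwall's argument: the squared norm, damped by an exponential, cannot increase.
\<close>

lemma linear_growth_from_zero_is_zero:
  fixes D :: "real \<Rightarrow> 'a :: real_inner"
  assumes der: "\<And>s. s \<in> {0..T} \<Longrightarrow> (D has_vector_derivative D' s) (at s within {0..T})"
    and bound: "\<And>s. s \<in> {0..T} \<Longrightarrow> norm (D' s) \<le> K * norm (D s)"
    and init: "D 0 = 0" and t: "t \<in> {0..T}"
  shows "D t = 0"
proof -
  define g where "g s = exp (- (2 * K * s)) * (D s \<bullet> D s)" for s
  have der_g: "(g has_real_derivative
      exp (- (2 * K * s)) * (2 * (D s \<bullet> D' s) - 2 * K * (D s \<bullet> D s))) (at s within {0..T})"
    if "s \<in> {0..T}" for s
  proof -
    have "((\<lambda>s. D s \<bullet> D s) has_vector_derivative D s \<bullet> D' s + D' s \<bullet> D s) (at s within {0..T})"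
      by (rule bounded_bilinear.has_vector_derivative[OF bounded_bilinear_inner der[OF that] der[OF that]])
    then have "((\<lambda>s. D s \<bullet> D s) has_real_derivative D s \<bullet> D' s + D' s \<bullet> D s) (at s within {0..T})"
      by (simp add: has_real_derivative_iff_has_vector_derivative)
    then show ?thesis
      unfolding g_def by (auto intro!: derivative_eq_intros simp: algebra_simps inner_commute)
  qed
  have cont: "continuous_on {0..t} g"
    by (rule continuous_on_subset[OF DERIV_continuous_on[OF der_g]]) (use t in auto)
  have "\<exists>l. (g has_real_derivative l) (at s) \<and> l \<le> 0" if s: "0 < s" "s < t" for s
  proof (intro exI conjI)
    show "(g has_real_derivative
      exp (- (2 * K * s)) * (2 * (D s \<bullet> D' s) - 2 * K * (D s \<bullet> D s))) (at s)"
      using der_g[of s] s t at_within_interior[of s "{0..T}"] by auto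
    have "D s \<bullet> D' s \<le> norm (D s) * norm (D' s)"
      by (rule norm_cauchy_schwarz)
    also have "\<dots> \<le> norm (D s) * (K * norm (D s))"
      using bound[of s] s t by (intro mult_left_mono) auto
    also have "\<dots> = K * (D s \<bullet> D s)"
      by (simp add: dot_square_norm power2_eq_square)
    finally show "exp (- (2 * K * s)) * (2 * (D s \<bullet> D' s) - 2 * K * (D s \<bullet> D s)) \<le> 0"
      by (intro mult_nonneg_nonpos) auto
  qed
  then have "g t \<le> g 0"
    using t by (intro DERIV_nonpos_imp_decreasing_open[OF _ _ cont]) auto
  then have "D t \<bullet> D t \<le> 0"
    by (simp add: g_def init mult_le_0_iff)
  then show ?thesis
    by (metis inner_eq_zero_iff inner_ge_zero order_antisym)
qed

text \<open>
  The antisymmetric part D of a solution satisfies the homogeneous linear equation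
  \<open>D' = (A - X\<^sup>T M) D + D (A\<^sup>T - M X)\<close>, since the quadratic terms
  differ by \<open>X M X - X\<^sup>T M X\<^sup>T = D M X + X\<^sup>T M D\<close>, and it starts at zero.
\<close>

lemma riccati_symmetric:
  fixes X :: "real \<Rightarrow> real ^ 'n ^ 'n"
  assumes der: "\<And>s. s \<in> {0..T} \<Longrightarrow>
      (X has_vector_derivative (A ** X s + X s ** transpose A - X s ** M ** X s + W))
        (at s within {0..T})"
    and M: "transpose M = M" and W: "transpose W = W" and X0: "transpose (X 0) = X 0"
    and t: "t \<in> {0..T}"
  shows "transpose (X t) = X t"
proof -
  interpret mult: bounded_bilinear "(**) :: real ^ 'n ^ 'n \<Rightarrow> real ^ 'n ^ 'n \<Rightarrow> real ^ 'n ^ 'n"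
    by (rule bounded_bilinear_matrix_mult)
  interpret tr: bounded_linear "transpose :: real ^ 'n ^ 'n \<Rightarrow> real ^ 'n ^ 'n"
    by (rule bounded_linear_transpose)
  define D where "D s = X s - transpose (X s)" for s
  define G where "G s = A - transpose (X s) ** M" for s
  define H where "H s = transpose A - M ** X s" for s
  have der_D: "(D has_vector_derivative (G s ** D s + D s ** H s)) (at s within {0..T})"
    if "s \<in> {0..T}" for s
  proof -
    let ?X' = "A ** X s + X s ** transpose A - X s ** M ** X s + W"
    have "(D has_vector_derivative ?X' - transpose ?X') (at s within {0..T})"
      unfolding D_def
      by (intro has_vector_derivative_diff tr.has_vector_derivative der that)
    moreover have "?X' - transpose ?X' = G s ** D s + D s ** H s"
      by (simp add: D_def G_def H_def tr.add tr.diff matrix_transpose_mul M W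
          mult.diff_left mult.diff_right matrix_mul_assoc)
    ultimately show ?thesis
      by simp
  qed
  have contX: "continuous_on {0..T} X"
    using der by (intro continuous_on_vector_derivative)
  have "continuous_on {0..T} G" "continuous_on {0..T} H"
    unfolding G_def H_def
    by (intro continuous_on_diff continuous_on_const mult.continuous_on tr.continuous_on contX)+
  then have "bounded (G ` {0..T})" "bounded (H ` {0..T})"
    by (auto intro!: compact_imp_bounded compact_continuous_image)
  then obtain g h where g: "\<And>s. s \<in> {0..T} \<Longrightarrow> norm (G s) \<le> g"
    and h: "\<And>s. s \<in> {0..T} \<Longrightarrow> norm (H s) \<le> h"
    unfolding bounded_iff by blast
  obtain b where b: "b > 0" "\<And>(E :: real ^ 'n ^ 'n) (F :: real ^ 'n ^ 'n). norm (E ** F) \<le> norm E * norm F * b"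
    using mult.pos_bounded by blast
  have "norm (G s ** D s + D s ** H s) \<le> (g * b + h * b) * norm (D s)" if s: "s \<in> {0..T}" for s
  proof -
    have "norm (G s ** D s + D s ** H s) \<le> norm (G s) * norm (D s) * b + norm (D s) * norm (H s) * b"
      by (rule order_trans[OF norm_triangle_ineq add_mono[OF b(2) b(2)]])
    also have "\<dots> \<le> g * norm (D s) * b + norm (D s) * h * b"
      using b(1) g[OF s] h[OF s] by (intro add_mono mult_right_mono mult_left_mono) auto
    finally show ?thesis
      by (simp add: algebra_simps)
  qed
  then have "D t = 0"
    by (intro linear_growth_from_zero_is_zero[OF der_D _ _ t]) (auto simp: D_def X0)
  then show ?thesis
    by (simp add: D_def)
qed

text \<open>
  Positivity survives because the smallest eigenvalue of \<open>X\<close> can decay at most exponentially.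
  To avoid differentiating eigenvalues, \<open>X\<close> is compared with a barrier
  \<open>\<mu> s = \<delta> exp (-c s)\<close> which lies below all eigenvalues at time 0.  Suppose that some eigenvalue
  reaches the barrier and look at the first time \<open>s\<close> at which this happens, with unit vector z.
  There z is an eigenvector with eigenvalue \<open>\<mu> s\<close>, so the derivative of the form
  \<open>z \<bullet> (X *v z)\<close> equals
  \<open>2 \<mu> (z \<bullet> (A *v z)) - \<mu>\<^sup>2 (z \<bullet> (M *v z)) + z \<bullet> (W *v z)\<close>, and for a large enough constant c
  this exceeds the derivative \<open>- c \<mu>\<close> of the barrier.  Hence the form was below the barrier
  just before \<open>s\<close>, a contradiction.
\<close>

lemma riccati_pos_def:
  fixes X :: "real \<Rightarrow> real ^ 'n ^ 'n"
  assumes der: "\<And>s. s \<in> {0..T} \<Longrightarrow>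
      (X has_vector_derivative (A ** X s + X s ** transpose A - X s ** M ** X s + W))
        (at s within {0..T})"
    and M: "transpose M = M" and W: "transpose W = W"
    and W_nonneg: "\<And>z. sq_norm_wrt W z \<ge> 0" and X0: "sym_pos_def (X 0)"
    and t: "t \<in> {0..T}"
  shows "sym_pos_def (X t)"
proof -
  have sym: "transpose (X s) = X s" if "s \<in> {0..T}" for s
    using X0 by (intro riccati_symmetric[OF der M W _ that]) (auto simp: sym_pos_def_def)
  have contX: "continuous_on {0..T} X"
    using der by (intro continuous_on_vector_derivative)
  obtain \<delta>0 where \<delta>0: "\<delta>0 > 0" "\<And>x. \<delta>0 * (norm x)\<^sup>2 \<le> sq_norm_wrt (X 0) x"
    using sym_pos_def_coercive[OF X0] by blast
  define \<delta> where "\<delta> = min 1 (\<delta>0 / 2)"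
  have \<delta>: "0 < \<delta>" "\<delta> \<le> 1" "\<delta> < \<delta>0"
    using \<delta>0(1) by (auto simp: \<delta>_def)
  define a m where "a = onorm ((*v) A)" and "m = onorm ((*v) M)"
  have form_bound: "\<bar>z \<bullet> (L *v z)\<bar> \<le> onorm ((*v) L)" if "norm z = 1" for L :: "real ^ 'n ^ 'n" and z
    using Cauchy_Schwarz_ineq2[of z "L *v z"] onorm[of "(*v) L" z] that by auto
  have m: "m \<ge> 0"
    unfolding m_def by (rule onorm_pos_le) simp
  (* 2 a + m bounds the possible decay rate as the barrier is at most 1; the extra 1 makes
     the comparison strict *)
  define c where "c = 2 * a + m + 1"
  have c: "c \<ge> 0"
    using m onorm_pos_le[of "(*v) A"] by (simp add: c_def a_def)
  define \<mu> where "\<mu> s = \<delta> * exp (- (c * s))" for s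
  have \<mu>_pos: "\<mu> s > 0" for s
    using \<delta> by (simp add: \<mu>_def)
  have \<mu>_le: "\<mu> s \<le> 1" if "s \<ge> 0" for s
    using \<delta> c that by (simp add: \<mu>_def mult_le_one)
  (* times and unit vectors at which the barrier has been reached; Z is compact, so that
     nonemptiness provides a first time *)
  define Z where "Z = {p \<in> {0..T} \<times> sphere (0 :: real ^ 'n) 1. sq_norm_wrt (X (fst p)) (snd p) - \<mu> (fst p) \<le> 0}"
  have "Z = {}"
  proof (rule ccontr)
    assume "Z \<noteq> {}"
    have "continuous_on ({0..T} \<times> sphere 0 1) (\<lambda>p. sq_norm_wrt (X (fst p)) (snd p) - \<mu> (fst p))"
    proof -
      have "bounded_bilinear (\<lambda>(M :: real ^ 'n ^ 'n) z. M *v z)"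
        unfolding bilinear_conv_bounded_bilinear[symmetric] bilinear_def
        by (auto intro!: linearI simp: matrix_vector_mult_add_rdistrib matrix_vector_right_distrib
            matrix_vector_mult_scaleR simp flip: scaleR_matrix_vector_assoc)
      moreover have "continuous_on ({0..T} \<times> sphere (0 :: real ^ 'n) 1) (\<lambda>p. X (fst p))"
        by (rule continuous_on_compose2[OF contX]) (auto intro: continuous_intros)
      ultimately show ?thesis
        unfolding sq_norm_wrt_def \<mu>_def
        by (intro continuous_intros bounded_bilinear.continuous_on[of "(*v)"]) auto
    qed
    then have "closed (({0..T} \<times> sphere 0 1) \<inter>
        (\<lambda>p. sq_norm_wrt (X (fst p)) (snd p) - \<mu> (fst p)) -` {..0})"
      by (rule continuous_closed_preimage) (auto intro: closed_Times)
    moreover have "Z = ({0..T} \<times> sphere 0 1) \<inter>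
        (\<lambda>p. sq_norm_wrt (X (fst p)) (snd p) - \<mu> (fst p)) -` {..0}"
      by (auto simp: Z_def)
    ultimately have "closed Z"
      by simp
    moreover have "bounded Z"
      by (rule bounded_subset[of "{0..T} \<times> sphere 0 1"]) (auto simp: Z_def bounded_Times)
    ultimately have "compact Z"
      by (simp add: compact_eq_bounded_closed)
    then obtain p where "p \<in> Z" and first: "\<And>q. q \<in> Z \<Longrightarrow> fst p \<le> fst q"
      using continuous_attains_inf[of Z fst] \<open>Z \<noteq> {}\<close> continuous_on_fst[OF continuous_on_id]
      by blast
    then obtain s z where p: "p = (s, z)" and s: "s \<in> {0..T}" and z: "norm z = 1"
      and touch: "sq_norm_wrt (X s) z \<le> \<mu> s"
      by (cases p) (auto simp: Z_def)
    have above: "\<mu> r < sq_norm_wrt (X r) w" if "0 \<le> r" "r < s" "norm w = 1" for r w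
      using first[of "(r, w)"] that s by (force simp: Z_def p)
    have "s \<noteq> 0"
      using \<delta>0(2)[of z] touch \<delta> z by (auto simp: \<mu>_def)
    then have s_pos: "s > 0"
      using s by simp
    have cont_form: "continuous_on {0..T} (\<lambda>r. sq_norm_wrt (X r) w - \<mu> r)" for w
      unfolding \<mu>_def
      by (intro continuous_intros bounded_linear.continuous_on[OF bounded_linear_quadratic_form] contX)
    have above_s: "\<mu> s \<le> sq_norm_wrt (X s) w" if "norm w = 1" for w
    proof -
      have "continuous_on {0..s} (\<lambda>r. sq_norm_wrt (X r) w - \<mu> r)"
        using s by (intro continuous_on_subset[OF cont_form]) auto
      then have "continuous (at s within {0..s}) (\<lambda>r. sq_norm_wrt (X r) w - \<mu> r)"
        using s by (simp add: continuous_on_eq_continuous_within)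
      then have "continuous (at s within {0..<s}) (\<lambda>r. sq_norm_wrt (X r) w - \<mu> r)"
        by (rule continuous_within_subset) auto
      then have "((\<lambda>r. sq_norm_wrt (X r) w - \<mu> r) \<longlongrightarrow> sq_norm_wrt (X s) w - \<mu> s) (at s within {0..<s})"
        by (simp add: continuous_within)
      moreover have "\<forall>\<^sub>F r in at s within {0..<s}. 0 \<le> sq_norm_wrt (X r) w - \<mu> r"
        using above that by (auto simp: eventually_at intro!: exI[of _ 1] less_imp_le)
      moreover have "at s within {0..<s} \<noteq> bot"
        using s_pos by (simp add: at_within_eq_bot_iff)
      ultimately have "0 \<le> sq_norm_wrt (X s) w - \<mu> s"
        using tendsto_lowerbound by blast
      then show ?thesis
        by simp
    qed
    (* z minimizes the form on the unit sphere, hence is an eigenvector *)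
    have eigen: "X s *v z = \<mu> s *\<^sub>R z"
    proof -
      let ?E = "X s - \<mu> s *\<^sub>R mat 1"
      have E: "?E *v w = X s *v w - \<mu> s *\<^sub>R w" for w
        by (simp add: matrix_vector_mult_diff_rdistrib flip: scaleR_matrix_vector_assoc)
      have form_E: "sq_norm_wrt ?E w = sq_norm_wrt (X s) w - \<mu> s * (norm w)\<^sup>2" for w
        by (simp add: sq_norm_wrt_def E inner_diff_right power2_norm_eq_inner)
      have nonneg: "sq_norm_wrt ?E w \<ge> 0" for w
      proof (cases "w = 0")
        case False
        then have "\<mu> s \<le> sq_norm_wrt (X s) ((1 / norm w) *\<^sub>R w)"
          by (intro above_s) simp
        also have "\<dots> = sq_norm_wrt (X s) w / (norm w)\<^sup>2"
          by (simp add: sq_norm_wrt_scaleR power_divide)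
        finally show ?thesis
          using False by (simp add: form_E field_simps)
      qed (simp add: sq_norm_wrt_def)
      have "transpose ?E = ?E"
        by (simp add: sym[OF s] transpose_scalar
            linear_diff[OF bounded_linear.linear[OF bounded_linear_transpose]])
      moreover have "sq_norm_wrt ?E z = 0"
        using nonneg[of z] touch z unfolding form_E by simp
      ultimately have "?E *v z = 0"
        using nonneg by (intro nonneg_form_zero_imp_kernel)
      then show ?thesis
        by (simp add: E)
    qed
    let ?X' = "A ** X s + X s ** transpose A - X s ** M ** X s + W"
    have form': "sq_norm_wrt ?X' z =
        2 * \<mu> s * (z \<bullet> (A *v z)) - (\<mu> s)\<^sup>2 * (z \<bullet> (M *v z)) + sq_norm_wrt W z"
    proof -
      have X_left: "z \<bullet> (X s *v w) = \<mu> s * (z \<bullet> w)" for w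
        using inner_mult_symmetric[OF sym[OF s], of z w] by (simp add: eigen inner_commute)
      have "z \<bullet> (transpose A *v z) = z \<bullet> (A *v z)"
        by (simp only: inner_mult_transpose inner_commute)
      then show ?thesis
        by (simp add: sq_norm_wrt_def matrix_vector_mult_add_rdistrib matrix_vector_mult_diff_rdistrib
            inner_add_right inner_diff_right X_left eigen matrix_vector_mult_scaleR
            power2_eq_square del: transpose_matrix_vector flip: matrix_vector_mul_assoc)
    qed
    have "((\<lambda>r. sq_norm_wrt (X r) z) has_real_derivative sq_norm_wrt ?X' z) (at s within {0..T})"
      unfolding has_real_derivative_iff_has_vector_derivative
      by (rule bounded_linear.has_vector_derivative[OF bounded_linear_quadratic_form der[OF s]])
    then have "((\<lambda>r. sq_norm_wrt (X r) z - \<mu> r) has_real_derivative sq_norm_wrt ?X' z + c * \<mu> s)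
        (at s within {0..T})"
      unfolding \<mu>_def by (auto intro!: derivative_eq_intros)
    moreover have "sq_norm_wrt ?X' z + c * \<mu> s > 0"
    proof -
      have "\<mu> s * (z \<bullet> (A *v z)) \<ge> - (\<mu> s * a)"
        using mult_left_mono[of "- a" "z \<bullet> (A *v z)" "\<mu> s"] form_bound[OF z, of A] \<mu>_pos[of s]
        by (simp add: a_def)
      moreover have "(\<mu> s)\<^sup>2 * (z \<bullet> (M *v z)) \<le> \<mu> s * m"
      proof -
        have "(\<mu> s)\<^sup>2 * (z \<bullet> (M *v z)) \<le> (\<mu> s)\<^sup>2 * m"
          using form_bound[OF z, of M] by (intro mult_left_mono) (auto simp: m_def)
        also have "\<dots> \<le> \<mu> s * m"
          using \<mu>_le[of s] \<mu>_pos[of s] s m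
          by (intro mult_right_mono) (auto simp: power2_eq_square mult_left_le)
        finally show ?thesis .
      qed
      ultimately have "sq_norm_wrt ?X' z + c * \<mu> s \<ge> \<mu> s"
        using W_nonneg[of z] unfolding form' by (simp add: c_def algebra_simps)
      then show ?thesis
        using \<mu>_pos[of s] by simp
    qed
    ultimately obtain d where "d > 0"
      and d: "\<And>h. 0 < h \<Longrightarrow> s - h \<in> {0..T} \<Longrightarrow> h < d \<Longrightarrow>
        sq_norm_wrt (X (s - h)) z - \<mu> (s - h) < sq_norm_wrt (X s) z - \<mu> s"
      using has_real_derivative_pos_inc_left by blast
    define h where "h = min s (d / 2)"
    have "0 < h" "h \<le> s" "h < d"
      using s_pos \<open>d > 0\<close> by (auto simp: h_def)
    then have "sq_norm_wrt (X (s - h)) z < \<mu> (s - h)"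
      using d[of h] s touch by auto
    then show False
      using above[of "s - h" z] \<open>0 < h\<close> \<open>h \<le> s\<close> z by auto
  qed
  have "x \<bullet> (X t *v x) > 0" if "x \<noteq> 0" for x
  proof -
    have "\<mu> t < sq_norm_wrt (X t) ((1 / norm x) *\<^sub>R x)"
    proof (rule ccontr)
      assume "\<not> \<mu> t < sq_norm_wrt (X t) ((1 / norm x) *\<^sub>R x)"
      then have "(t, (1 / norm x) *\<^sub>R x) \<in> Z"
        using t that by (simp add: Z_def)
      then show False
        using \<open>Z = {}\<close> by simp
    qed
    then have "0 < sq_norm_wrt (X t) ((1 / norm x) *\<^sub>R x)"
      using \<mu>_pos[of t] by linarith
    then show ?thesis
      unfolding sq_norm_wrt_scaleR by (simp add: sq_norm_wrt_def zero_less_mult_iff)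
  qed
  with sym[OF t] show ?thesis
    by (simp add: sym_pos_def_def)
qed

section \<open>The maximum of finitely many positive definite quadratic functions\<close>

text \<open>
  The growth of a single quadratic function makes the sublevel sets of the maximum compact.
\<close>

lemma max_quadratic_attains_min:
  fixes P :: "'k \<Rightarrow> real ^ 'n ^ 'n" and c :: "'k \<Rightarrow> real ^ 'n" and r :: "'k \<Rightarrow> real"
  assumes fin: "finite K" and ne: "K \<noteq> {}" and P: "\<And>k. k \<in> K \<Longrightarrow> sym_pos_def (P k)"
  defines "f \<equiv> \<lambda>x. Max ((\<lambda>k. sq_norm_wrt (P k) (x - c k) + r k) ` K)"
  shows "\<exists>x. \<forall>y. f x \<le> f y"
proof -
  have cont_q: "continuous_on UNIV (\<lambda>x. sq_norm_wrt (P k) (x - c k) + r k)" for k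
    unfolding sq_norm_wrt_def
    by (intro continuous_intros linear_continuous_on_compose[of _ "\<lambda>x. x - c k"]) auto
  have cont: "continuous_on UNIV f"
    unfolding f_def using fin ne
  proof (induction K rule: finite_ne_induct)
    case (insert k K)
    then show ?case
      using cont_q by (simp add: continuous_on_max)
  qed (use cont_q in simp)
  obtain k where k: "k \<in> K"
    using ne by blast
  obtain b where b: "b > 0" "\<And>x. b * (norm x)\<^sup>2 \<le> sq_norm_wrt (P k) x"
    using sym_pos_def_coercive[OF P[OF k]] by blast
  define S where "S = {x. f x \<le> f 0}"
  have "closed S"
    unfolding S_def by (intro closed_Collect_le cont continuous_on_const)
  moreover have "bounded S"
  proof -
    have "x \<in> cball (c k) (sqrt ((f 0 - r k) / b))" if "x \<in> S" for x
    proof -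
      have "b * (norm (x - c k))\<^sup>2 + r k \<le> sq_norm_wrt (P k) (x - c k) + r k"
        using b(2) by simp
      also have "\<dots> \<le> f x"
        unfolding f_def using fin k by (intro Max_ge) auto
      also have "\<dots> \<le> f 0"
        using that by (simp add: S_def)
      finally have "(norm (x - c k))\<^sup>2 \<le> (f 0 - r k) / b"
        using b(1) by (simp add: field_simps)
      then show ?thesis
        by (simp add: dist_norm norm_minus_commute real_le_rsqrt)
    qed
    then show ?thesis
      by (intro bounded_subset[OF bounded_cball]) auto
  qed
  ultimately have "compact S"
    by (simp add: compact_eq_bounded_closed)
  moreover have "0 \<in> S"
    by (simp add: S_def)
  ultimately obtain x where x: "x \<in> S" "\<And>y. y \<in> S \<Longrightarrow> f x \<le> f y"
    using continuous_attains_inf[of S f] continuous_on_subset[OF cont] by blast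
  have "f x \<le> f y" for y
  proof (cases "y \<in> S")
    case False
    then have "f 0 < f y"
      by (simp add: S_def)
    then show ?thesis
      using x(1) by (simp add: S_def)
  qed (rule x(2))
  then show ?thesis
    by blast
qed

text \<open>
  Strict convexity of every quadratic function: by the parallelogram identity its value at a
  midpoint is strictly below the mean of its values at the end points.
\<close>

lemma max_quadratic_min_unique:
  fixes P :: "'k \<Rightarrow> real ^ 'n ^ 'n" and c :: "'k \<Rightarrow> real ^ 'n" and r :: "'k \<Rightarrow> real"
  assumes fin: "finite K" and ne: "K \<noteq> {}" and P: "\<And>k. k \<in> K \<Longrightarrow> sym_pos_def (P k)"
  defines "f \<equiv> \<lambda>x. Max ((\<lambda>k. sq_norm_wrt (P k) (x - c k) + r k) ` K)"
  assumes x: "\<And>z. f x \<le> f z" and y: "\<And>z. f y \<le> f z"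
  shows "x = y"
proof (rule ccontr)
  assume "x \<noteq> y"
  have f_less: "f z < b" if "\<And>k. k \<in> K \<Longrightarrow> sq_norm_wrt (P k) (z - c k) + r k < b" for z b
    unfolding f_def using fin ne that by simp
  define m h where "m = (1 / 2) *\<^sub>R (x + y)" and "h = (1 / 2) *\<^sub>R (x - y)"
  have "x = m + h" "y = m + (- h)"
    by (simp_all add: m_def h_def flip: scaleR_add_right scaleR_diff_right scaleR_minus_right)
  then have xy: "x - c k = (m - c k) + h" "y - c k = (m - c k) + (- h)" for k
    by simp_all
  have "h \<noteq> 0"
    using \<open>x \<noteq> y\<close> by (simp add: h_def)
  have "sq_norm_wrt (P k) (m - c k) + r k < f x" if k: "k \<in> K" for k
  proof -
    have sym: "transpose (P k) = P k" and pos: "sq_norm_wrt (P k) h > 0"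
      using P[OF k] \<open>h \<noteq> 0\<close> by (auto simp: sym_pos_def_def sq_norm_wrt_def)
    have "sq_norm_wrt (P k) (- h) = sq_norm_wrt (P k) h"
      using sq_norm_wrt_scaleR[of "P k" "-1" h] by simp
    then have "sq_norm_wrt (P k) (x - c k) + sq_norm_wrt (P k) (y - c k)
        = 2 * sq_norm_wrt (P k) (m - c k) + 2 * sq_norm_wrt (P k) h"
      unfolding xy sq_norm_wrt_add[OF sym] by simp
    moreover have "sq_norm_wrt (P k) (x - c k) + r k \<le> f x" "sq_norm_wrt (P k) (y - c k) + r k \<le> f y"
      unfolding f_def using fin k by (auto intro: Max_ge)
    moreover have "f x = f y"
      using x y by (intro antisym)
    ultimately show ?thesis
      using pos by linarith
  qed
  then have "f m < f x"
    by (intro f_less) auto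
  then show False
    using x[of m] by simp
qed

text \<open>
  Half of the gradient of the k-th function at x is \<open>P k *v (x - c k)\<close>.  If the convex hull of the
  gradients of the active functions misses the origin, a hyperplane separates the two, and a small
  step against its normal decreases all active functions at once; the inactive ones stay
  below the maximum by continuity.
\<close>

lemma max_quadratic_min_zero_in_hull:
  fixes P :: "'k \<Rightarrow> real ^ 'n ^ 'n" and c :: "'k \<Rightarrow> real ^ 'n" and r :: "'k \<Rightarrow> real"
  assumes fin: "finite K" and ne: "K \<noteq> {}" and P: "\<And>k. k \<in> K \<Longrightarrow> transpose (P k) = P k"
  defines "q \<equiv> \<lambda>k x. sq_norm_wrt (P k) (x - c k) + r k"
  defines "f \<equiv> \<lambda>x. Max ((\<lambda>k. q k x) ` K)"
  assumes x: "\<And>z. f x \<le> f z"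
  shows "0 \<in> convex hull ((\<lambda>k. P k *v (x - c k)) ` {k \<in> K. q k x = f x})"
    (is "0 \<in> convex hull (?g ` ?I)")
proof (rule ccontr)
  assume "0 \<notin> convex hull (?g ` ?I)"
  moreover have "closed (convex hull (?g ` ?I))"
    using fin by (intro compact_imp_closed finite_imp_compact_convex_hull) auto
  ultimately obtain a b where ab: "0 < b" "\<And>v. v \<in> convex hull (?g ` ?I) \<Longrightarrow> b < a \<bullet> v"
    using separating_hyperplane_closed_0[OF convex_convex_hull] by blast
  have f_less: "f z < b" if "\<And>k. k \<in> K \<Longrightarrow> q k z < b" for z b
    unfolding f_def using fin ne that by simp
  have descent: "a \<bullet> ?g k > 0" if "k \<in> ?I" for k
  proof -
    have "?g k \<in> convex hull (?g ` ?I)"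
      using that by (intro hull_inc) blast
    then show ?thesis
      using ab by force
  qed
  have expand: "q k (x + (- e) *\<^sub>R a) = q k x - e * (2 * (a \<bullet> ?g k) - e * sq_norm_wrt (P k) a)"
    if "k \<in> K" for k e
  proof -
    have "q k (x + (- e) *\<^sub>R a) = sq_norm_wrt (P k) ((x - c k) + (- e) *\<^sub>R a) + r k"
      unfolding q_def by (simp add: algebra_simps)
    then show ?thesis
      unfolding sq_norm_wrt_add[OF P[OF that]] sq_norm_wrt_scaleR q_def
      by (simp add: power2_eq_square algebra_simps)
  qed
  have "\<forall>\<^sub>F e in at_right 0. q k (x + (- e) *\<^sub>R a) < f x" if k: "k \<in> K" for k
  proof (cases "q k x = f x")
    case True
    have "((\<lambda>e. 2 * (a \<bullet> ?g k) - e * sq_norm_wrt (P k) a) \<longlongrightarrow> 2 * (a \<bullet> ?g k) - 0 * sq_norm_wrt (P k) a)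
        (at_right 0)"
      by (intro tendsto_intros)
    then have "\<forall>\<^sub>F e in at_right 0. 0 < 2 * (a \<bullet> ?g k) - e * sq_norm_wrt (P k) a"
      by (rule order_tendstoD(1)) (use descent[of k] k True in simp)
    moreover have "\<forall>\<^sub>F e in at_right 0. (0 :: real) < e"
      by (rule eventually_at_right_less)
    ultimately show ?thesis
    proof eventually_elim
      case (elim e)
      then show ?case
        unfolding expand[OF k] True by simp
    qed
  next
    case False
    have "q k x \<le> f x"
      unfolding f_def using fin k by (intro Max_ge) auto
    with False have "q k x < f x"
      by simp
    moreover have "((\<lambda>e. q k x - e * (2 * (a \<bullet> ?g k) - e * sq_norm_wrt (P k) a))
        \<longlongrightarrow> q k x - 0 * (2 * (a \<bullet> ?g k) - 0 * sq_norm_wrt (P k) a)) (at_right 0)"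
      by (intro tendsto_intros)
    ultimately show ?thesis
      unfolding expand[OF k] by (intro order_tendstoD) auto
  qed
  then have "\<forall>\<^sub>F e in at_right 0. \<forall>k\<in>K. q k (x + (- e) *\<^sub>R a) < f x"
    using fin by (simp add: eventually_ball_finite)
  then obtain e where "\<forall>k\<in>K. q k (x + (- e) *\<^sub>R a) < f x"
    using eventually_happens'[OF trivial_limit_at_right_real] by blast
  then have "f (x + (- e) *\<^sub>R a) < f x"
    by (intro f_less) auto
  then show False
    using x[of "x + (- e) *\<^sub>R a"] by simp
qed

section \<open>Caratheodory's theorem with affinely independent points\<close>

text \<open>
  In a representation by as few points as possible the points are affinely independent, because
  Caratheodory's bound in terms of the affine dimension would shorten any other representation.
\<close>

lemma convex_hull_affine_independent_subset:
  fixes p :: "'a :: euclidean_space set"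
  assumes "x \<in> convex hull p"
  shows "\<exists>S \<subseteq> p. finite S \<and> \<not> affine_dependent S \<and> x \<in> convex hull S"
proof -
  define R where "R S \<longleftrightarrow> finite S \<and> S \<subseteq> p \<and> x \<in> convex hull S" for S
  have "\<exists>S. R S"
    using assms unfolding R_def by (subst (asm) caratheodory) blast
  then obtain S where S: "R S" and least: "\<And>S'. R S' \<Longrightarrow> card S \<le> card S'"
    using exists_least_iff[of "\<lambda>n. \<exists>S. R S \<and> card S = n"] by (metis not_less)
  have fin: "finite S"
    using S by (simp add: R_def)
  have "x \<in> convex hull S"
    using S by (simp add: R_def)
  then obtain S' where S': "finite S'" "S' \<subseteq> S" "int (card S') \<le> aff_dim S + 1" "x \<in> convex hull S'"
    unfolding caratheodory_aff_dim[of S] by blast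
  then have "card S \<le> card S'"
    using S by (intro least) (auto simp: R_def)
  then have "aff_dim S = int (card S) - 1"
    using S'(3) aff_dim_le_card[OF fin] by linarith
  then show ?thesis
    using S fin unfolding R_def affine_independent_iff_card by blast
qed

text \<open>
  For an indexed family, choosing one index for each point used excludes repetitions, and the
  coefficients carry over unchanged.
\<close>

lemma convex_hull_image_affinely_independent_family:
  fixes w :: "'i \<Rightarrow> real ^ 'n"
  assumes "x \<in> convex hull (w ` I)"
  shows "\<exists>S \<alpha>. S \<subseteq> I \<and> finite S \<and> card S \<le> CARD('n) + 1 \<and> affinely_independent_family w S \<and>
    (\<forall>k\<in>S. \<alpha> k \<in> {0..1}) \<and> (\<Sum>k\<in>S. \<alpha> k) = 1 \<and> (\<Sum>k\<in>S. \<alpha> k *\<^sub>R w k) = x"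
proof -
  obtain G where G: "G \<subseteq> w ` I" "finite G" "\<not> affine_dependent G" "x \<in> convex hull G"
    using convex_hull_affine_independent_subset[OF assms] by blast
  obtain S where S: "S \<subseteq> I" "inj_on w S" "G = w ` S"
    using G(1) unfolding subset_image_inj by blast
  have fin: "finite S"
    using G(2) S finite_imageD by blast
  obtain u where u: "\<And>v. v \<in> G \<Longrightarrow> 0 \<le> u v" "sum u G = 1" "(\<Sum>v\<in>G. u v *\<^sub>R v) = x"
    using G(4) unfolding convex_hull_finite[OF G(2)] by blast
  have "u (w k) \<le> 1" if "k \<in> S" for k
    using member_le_sum[of "w k" G u] u(1,2) G(2) S(3) that by auto
  moreover have "card S \<le> CARD('n) + 1"
    using affine_dependent_biggerset[OF G(2)] G(3) card_image[OF S(2)] S(3) by fastforce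
  moreover have "(\<Sum>k\<in>S. u (w k)) = 1" "(\<Sum>k\<in>S. u (w k) *\<^sub>R w k) = x"
    using u(2,3) by (simp_all add: S(3) sum.reindex[OF S(2)])
  ultimately show ?thesis
    using S G(3) u(1) fin
    by (intro exI[of _ S] exI[of _ "\<lambda>k. u (w k)"]) (auto simp: affinely_independent_family_def)
qed

text \<open>
  On a nonzero kernel vector a sum of nonnegative terms vanishes while every form is positive,
  which would force all weights to be zero.
\<close>

lemma convex_combination_sym_pos_def_invertible:
  fixes P :: "'k \<Rightarrow> real ^ 'n ^ 'n"
  assumes fin: "finite S" and P: "\<And>k. k \<in> S \<Longrightarrow> sym_pos_def (P k)"
    and \<alpha>: "\<And>k. k \<in> S \<Longrightarrow> \<alpha> k \<ge> 0" and sum: "(\<Sum>k\<in>S. \<alpha> k) = (1 :: real)"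
  shows "invertible (\<Sum>k\<in>S. \<alpha> k *\<^sub>R P k)"
proof (rule invertible_if_kernel_trivial, rule ccontr)
  fix x assume 0: "(\<Sum>k\<in>S. \<alpha> k *\<^sub>R P k) *v x = 0" and "x \<noteq> 0"
  have "(\<Sum>k\<in>S. \<alpha> k * sq_norm_wrt (P k) x) = 0"
    using 0 unfolding sq_norm_wrt_sum[symmetric] by (simp add: sq_norm_wrt_def)
  then have "\<forall>k\<in>S. \<alpha> k * sq_norm_wrt (P k) x = 0"
    using fin \<alpha> P by (subst (asm) sum_nonneg_eq_0_iff) (auto simp: sym_pos_def_nonneg)
  moreover have "sq_norm_wrt (P k) x > 0" if "k \<in> S" for k
    using P[OF that] \<open>x \<noteq> 0\<close> by (simp add: sym_pos_def_def sq_norm_wrt_def)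
  ultimately have "\<forall>k\<in>S. \<alpha> k = 0"
    by (metis less_irrefl mult_eq_0_iff)
  then show False
    using sum by simp
qed

section \<open>The estimator as a weighted mean of the filter states\<close>

lemma riccati_solution_sym_pos_def:
  assumes sol: "riccati_solution T A B C \<Gamma> R Q X"
    and \<Gamma>: "sym_pos_def \<Gamma>" and R: "sym_pos_def R" and Q: "sym_pos_def Q" and t: "t \<in> {0..T}"
  shows "sym_pos_def (X t)"
proof (rule riccati_pos_def[OF _ _ _ _ _ t])
  let ?M = "transpose C ** matrix_inv Q ** C" and ?W = "B ** R ** transpose B"
  show "(X has_vector_derivative (A ** X s + X s ** transpose A - X s ** ?M ** X s + ?W))
      (at s within {0..T})" if "s \<in> {0..T}" for s
    using sol that by (simp add: riccati_solution_def matrix_mul_assoc)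
  show "transpose ?M = ?M"
    using sym_pos_def_matrix_inv[OF Q]
    by (simp add: sym_pos_def_def matrix_transpose_mul matrix_mul_assoc)
  show "transpose ?W = ?W"
    using R by (simp add: sym_pos_def_def matrix_transpose_mul matrix_mul_assoc)
  show "sq_norm_wrt ?W z \<ge> 0" for z
  proof -
    have "sq_norm_wrt ?W z = sq_norm_wrt R (transpose B *v z)"
      using inner_mult_transpose[where M = "transpose B" and x = z and y = "R *v (transpose B *v z)"]
      by (simp add: sq_norm_wrt_def matrix_vector_mul_assoc matrix_mul_assoc
          del: transpose_matrix_vector)
    then show ?thesis
      by (simp add: sym_pos_def_nonneg[OF R] del: transpose_matrix_vector)
  qed
  show "sym_pos_def (X 0)"
    using sol \<Gamma> by (simp add: riccati_solution_def)
qed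

theorem theorem3p6:
  fixes T t :: real
    and B :: "real ^ 'm ^ 'n" and C :: "real ^ 'n ^ 'r"
    and x0 :: "real ^ 'n" and y :: "real \<Rightarrow> real ^ 'r"
    and SA :: "'a set" and SG :: "'g set" and SR :: "'b set" and SQ :: "'q set"
    and A :: "'a \<Rightarrow> real ^ 'n ^ 'n" and \<Gamma> :: "'g \<Rightarrow> real ^ 'n ^ 'n"
    and R :: "'b \<Rightarrow> real ^ 'm ^ 'm" and Q :: "'q \<Rightarrow> real ^ 'r ^ 'r"
    and N :: nat and \<sigma> :: "nat \<Rightarrow> 'a \<times> 'g \<times> 'b \<times> 'q"
    and Ak \<Gamma>k :: "nat \<Rightarrow> real ^ 'n ^ 'n"
    and Rk :: "nat \<Rightarrow> real ^ 'm ^ 'm" and Qk :: "nat \<Rightarrow> real ^ 'r ^ 'r"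
    and X P :: "nat \<Rightarrow> real \<Rightarrow> real ^ 'n ^ 'n"
    and xh :: "nat \<Rightarrow> real \<Rightarrow> real ^ 'n"
    and V :: "nat \<Rightarrow> real \<Rightarrow> real ^ 'n \<Rightarrow> real"
    and xinf :: "real \<Rightarrow> real ^ 'n"
  assumes T_pos: "T > 0"
    and y_L2: "y \<in> L2 T"
    and fin: "finite SA" "finite SG" "finite SR" "finite SQ"
    and nonempty: "SA \<noteq> {}" "SG \<noteq> {}" "SR \<noteq> {}" "SQ \<noteq> {}"
    and N_def: "N = card (SA \<times> SG \<times> SR \<times> SQ)"
    and enumeration: "bij_betw \<sigma> {1..N} (SA \<times> SG \<times> SR \<times> SQ)"
    and \<Gamma>_spd: "\<And>g. g \<in> SG \<Longrightarrow> sym_pos_def (\<Gamma> g)"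
    and R_spd: "\<And>b. b \<in> SR \<Longrightarrow> sym_pos_def (R b)"
    and Q_spd: "\<And>q. q \<in> SQ \<Longrightarrow> sym_pos_def (Q q)"
    and Ak_def: "\<And>k. Ak k = A (fst (\<sigma> k))"
    and \<Gamma>k_def: "\<And>k. \<Gamma>k k = \<Gamma> (fst (snd (\<sigma> k)))"
    and Rk_def: "\<And>k. Rk k = R (fst (snd (snd (\<sigma> k))))"
    and Qk_def: "\<And>k. Qk k = Q (snd (snd (snd (\<sigma> k))))"
    and riccati: "\<And>k. k \<in> {1..N} \<Longrightarrow>
          riccati_solution T (Ak k) B C (\<Gamma>k k) (Rk k) (Qk k) (X k)"
    and P_def: "\<And>k s. P k s = matrix_inv (X k s)"
    and filters: "\<And>k. k \<in> {1..N} \<Longrightarrow>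
          filter_solution T (Ak k) C (Qk k) (X k) y x0 (xh k)"
    and V_def: "\<And>k. V k = value_fun C (Qk k) y (X k) (xh k)"
    and xinf_def: "\<And>s. xinf s = minimax_estimator N V s"
    and t: "t \<in> {0..T}"
  shows "\<exists>S (\<alpha> :: nat \<Rightarrow> real).
           S \<subseteq> active_indices N V t (xinf t) \<and>
           card S \<le> CARD('n) + 1 \<and>
           (\<forall>k\<in>S. \<alpha> k \<in> {0..1}) \<and>
           (\<Sum>k\<in>S. \<alpha> k) = 1 \<and>
           affinely_independent_family (\<lambda>k. P k t *v (xinf t - xh k t)) S \<and>
           invertible (\<Sum>k\<in>S. \<alpha> k *\<^sub>R P k t) \<and>
           xinf t = matrix_inv (\<Sum>k\<in>S. \<alpha> k *\<^sub>R P k t) *v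
                      (\<Sum>k\<in>S. \<alpha> k *\<^sub>R (P k t *v xh k t))"
proof -
  have N: "{1..N} \<noteq> {}"
    using fin nonempty unfolding N_def by (simp add: Suc_le_eq card_gt_0_iff)
  have P: "sym_pos_def (P k t)" if k: "k \<in> {1..N}" for k
  proof -
    have "\<sigma> k \<in> SA \<times> SG \<times> SR \<times> SQ"
      using bij_betwE[OF enumeration] k by blast
    then have "sym_pos_def (\<Gamma>k k)" "sym_pos_def (Rk k)" "sym_pos_def (Qk k)"
      by (auto simp: \<Gamma>k_def Rk_def Qk_def mem_Times_iff intro: \<Gamma>_spd R_spd Q_spd)
    then show ?thesis
      unfolding P_def
      by (intro sym_pos_def_matrix_inv riccati_solution_sym_pos_def[OF riccati[OF k]] t)
  qed
  define r where "r k = residual C (Qk k) y (xh k) t" for k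
  have V: "V k t x = sq_norm_wrt (P k t) (x - xh k t) + r k" for k x
    by (simp add: V_def value_fun_def P_def r_def)
  let ?f = "\<lambda>x. Max ((\<lambda>k. sq_norm_wrt (P k t) (x - xh k t) + r k) ` {1..N})"
  have f: "max_cost N V t = ?f"
    by (simp add: fun_eq_iff max_cost_def V)
  have argmin: "is_arg_min (max_cost N V t) (\<lambda>_. True) x \<longleftrightarrow> (\<forall>z. ?f x \<le> ?f z)" for x
    unfolding is_arg_min_def f by (auto simp: not_less)
  have "\<exists>!x. is_arg_min (max_cost N V t) (\<lambda>_. True) x"
    unfolding argmin
  proof (rule ex_ex1I)
    show "\<exists>x. \<forall>z. ?f x \<le> ?f z"
      by (rule max_quadratic_attains_min[OF finite_atLeastAtMost N P])
    show "x = x'" if "\<forall>z. ?f x \<le> ?f z" "\<forall>z. ?f x' \<le> ?f z" for x x'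
      using that
      by (intro max_quadratic_min_unique[OF finite_atLeastAtMost N P,
            where c = "\<lambda>k. xh k t" and r = r]) auto
  qed
  then have "is_arg_min (max_cost N V t) (\<lambda>_. True) (xinf t)"
    unfolding xinf_def minimax_estimator_def by (rule theI')
  then have min: "?f (xinf t) \<le> ?f z" for z
    unfolding argmin by blast
  have active: "active_indices N V t (xinf t) =
      {k \<in> {1..N}. sq_norm_wrt (P k t) (xinf t - xh k t) + r k = ?f (xinf t)}"
    by (simp add: active_indices_def f V)
  let ?g = "\<lambda>k. P k t *v (xinf t - xh k t)"
  have zero: "0 \<in> convex hull (?g ` active_indices N V t (xinf t))"
    unfolding active
    by (rule max_quadratic_min_zero_in_hull[OF finite_atLeastAtMost N _ min])
      (use P in \<open>auto simp: sym_pos_def_def\<close>)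
  then obtain S \<alpha> where S: "S \<subseteq> active_indices N V t (xinf t)" "finite S" "card S \<le> CARD('n) + 1"
      "affinely_independent_family ?g S"
    and \<alpha>: "\<forall>k\<in>S. \<alpha> k \<in> {0..1}" "(\<Sum>k\<in>S. \<alpha> k) = 1" "(\<Sum>k\<in>S. \<alpha> k *\<^sub>R ?g k) = 0"
    using convex_hull_image_affinely_independent_family[OF zero] by blast
  let ?L = "\<Sum>k\<in>S. \<alpha> k *\<^sub>R P k t" and ?b = "\<Sum>k\<in>S. \<alpha> k *\<^sub>R (P k t *v xh k t)"
  have inv: "invertible ?L"
    using S(1,2) P \<alpha>(1,2)
    by (intro convex_combination_sym_pos_def_invertible) (auto simp: active)
  have "?L *v xinf t = (\<Sum>k\<in>S. \<alpha> k *\<^sub>R (P k t *v xinf t))"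
  proof -
    have "linear (\<lambda>M :: real ^ 'n ^ 'n. M *v xinf t)"
      by (rule linearI)
        (simp_all add: matrix_vector_mult_add_rdistrib flip: scaleR_matrix_vector_assoc)
    then show ?thesis
      by (simp add: linear_sum[of "\<lambda>M. M *v xinf t"] scaleR_matrix_vector_assoc)
  qed
  also have "\<dots> = ?b"
    using \<alpha>(3) by (simp add: matrix_vector_mult_diff_distrib scaleR_diff_right sum_subtractf)
  finally have "matrix_inv ?L *v ?b = matrix_inv ?L *v (?L *v xinf t)"
    by simp
  also have "\<dots> = xinf t"
    by (simp add: matrix_vector_mul_assoc matrix_inv_left[OF inv])
  finally have "xinf t = matrix_inv ?L *v ?b" ..
  with S \<alpha> inv show ?thesis
    by blast
qed

end
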